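(* Let $C:[0,1]^2\to[0,1]$ be a (bivariate) copula and let $f:[0,1]\to[0,1]$ be a function such that (1) $f$ is monotonically increasing (in the weak sense: $v_1\le v_2$ implies $f(v_1)\le f(v_2)$) with $f(1)=1$; (2) $f(v)\ge v$ for all $v\in[0,1]$; (3) $\dfrac{f(v_2)-f(v_1)}{v_2-v_1}\le 1$ for all $v_1,v_2\in[0,1]$ with $v_1\neq v_2$. Then the function $Q:[0,1]^2\to\mathbb{R}$ defined by $$Q(u,v)=C(u,f(v))-C(u,f(v)-v),\qquad u,v\in[0,1],$$ is a copula.
   Context: A function $C:[0,1]^2\to[0,1]$ is a (bivariate) copula if: (i) $C(u,0)=C(0,v)=0$ for all $u,v\in[0,1]$; (ii) $C(u,1)=u$ and $C(1,v)=v$ for all $u,v\in[0,1]$; (iii) for all $u_1\le u_2$ and $v_1\le v_2$ in $[0,1]$, $C(u_2,v_2)-C(u_2,v_1)-C(u_1,v_2)+C(u_1,v_1)\ge 0$. *)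

theory Defs
  imports Complex_Main
begin

(* Functions on the unit square are represented by total curried functions on the reals;
   only their values on [0,1] x [0,1] matter. *)
definition is_copula :: "(real \<Rightarrow> real \<Rightarrow> real) \<Rightarrow> bool" where
  "is_copula C \<longleftrightarrow>
     (\<forall>u\<in>{0..1}. \<forall>v\<in>{0..1}. C u v \<in> {0..1}) \<and>
     (\<forall>u\<in>{0..1}. C u 0 = 0) \<and> (\<forall>v\<in>{0..1}. C 0 v = 0) \<and>
     (\<forall>u\<in>{0..1}. C u 1 = u) \<and> (\<forall>v\<in>{0..1}. C 1 v = v) \<and>
     (\<forall>u1\<in>{0..1}. \<forall>u2\<in>{0..1}. \<forall>v1\<in>{0..1}. \<forall>v2\<in>{0..1}. u1 \<le> u2 \<longrightarrow> v1 \<le> v2 \<longrightarrow>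
        C u2 v2 - C u2 v1 - C u1 v2 + C u1 v1 \<ge> 0)"

end

theory Submission
  imports Defs
begin

text \<open>The slope condition says that \<open>v \<mapsto> f v - v\<close> is decreasing. Hence the \<open>Q\<close>-volume of
  \<open>[u1, u2] \<times> [v1, v2]\<close> is the sum of the \<open>C\<close>-volumes of \<open>[u1, u2] \<times> [f v1, f v2]\<close> and
  \<open>[u1, u2] \<times> [f v2 - v2, f v1 - v1]\<close>, both nonnegative.\<close>

lemma copula_volume_nonneg:
  assumes "is_copula C" "u1 \<in> {0..1}" "u2 \<in> {0..1}" "v1 \<in> {0..1}" "v2 \<in> {0..1}"
    and "u1 \<le> u2" "v1 \<le> v2"
  shows "0 \<le> C u2 v2 - C u2 v1 - C u1 v2 + C u1 v1"
  using assms unfolding is_copula_def by blast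

text \<open>The range condition comes from two volumes: that of
  \<open>[0, u] \<times> [0, v]\<close> is \<open>C u v\<close>, that of
  \<open>[u, 1] \<times> [0, v]\<close> is \<open>v - C u v\<close>. Hence
  \<open>0 \<le> C u v \<le> v \<le> 1\<close>.\<close>

lemma is_copulaI:
  assumes left: "\<And>u. u \<in> {0..1} \<Longrightarrow> C u 0 = 0" "\<And>v. v \<in> {0..1} \<Longrightarrow> C 0 v = 0"
    and right: "\<And>u. u \<in> {0..1} \<Longrightarrow> C u 1 = u" "\<And>v. v \<in> {0..1} \<Longrightarrow> C 1 v = v"
    and vol: "\<And>u1 u2 v1 v2. \<lbrakk>u1 \<in> {0..1}; u2 \<in> {0..1}; v1 \<in> {0..1}; v2 \<in> {0..1}; u1 \<le> u2; v1 \<le> v2\<rbrakk>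
      \<Longrightarrow> 0 \<le> C u2 v2 - C u2 v1 - C u1 v2 + C u1 v1"
  shows "is_copula C"
proof -
  have "C u v \<in> {0..1}" if u: "u \<in> {0..1}" and v: "v \<in> {0..1}" for u v
  proof -
    have "0 \<le> C u v"
      using vol[of 0 u 0 v] u v left by simp
    moreover have "C u v \<le> v"
      using vol[of u 1 0 v] u v left right by simp
    ultimately show ?thesis
      using v by simp
  qed
  then show ?thesis
    unfolding is_copula_def using left right vol by blast
qed

theorem theorem2:
  fixes C :: "real \<Rightarrow> real \<Rightarrow> real" and f :: "real \<Rightarrow> real"
  assumes "is_copula C"
    and "\<forall>v\<in>{0..1}. f v \<in> {0..1}"
    and "mono_on {0..1} f" and "f 1 = 1"
    and "\<forall>v\<in>{0..1}. f v \<ge> v"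
    and "\<forall>v1\<in>{0..1}. \<forall>v2\<in>{0..1}. v1 \<noteq> v2 \<longrightarrow> (f v2 - f v1) / (v2 - v1) \<le> 1"
  shows "is_copula (\<lambda>u v. C u (f v) - C u (f v - v))"
proof -
  \<comment> \<open>Both second arguments of \<open>C\<close> stay in its domain:
    \<open>v \<le> f v \<le> 1\<close> and \<open>0 \<le> v\<close> bound
    \<open>f v - v\<close>.\<close>
  have f: "f v \<in> {0..1}" and fd: "f v - v \<in> {0..1}" if "v \<in> {0..1}" for v
    using assms(2,5) that by force+
  have C: "C u 0 = 0" "C 0 u = 0" "C u 1 = u" "C 1 u = u" if "u \<in> {0..1}" for u
    using assms(1) that unfolding is_copula_def by blast+
  show ?thesis
  proof (rule is_copulaI)
    fix u1 u2 v1 v2 :: real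
    assume u: "u1 \<in> {0..1}" "u2 \<in> {0..1}" "u1 \<le> u2"
      and v: "v1 \<in> {0..1}" "v2 \<in> {0..1}" "v1 \<le> v2"
    have "f v1 \<le> f v2"
      using mono_onD[OF assms(3)] v by blast
    then have "0 \<le> C u2 (f v2) - C u2 (f v1) - C u1 (f v2) + C u1 (f v1)"
      using copula_volume_nonneg assms(1) u v f by blast
    moreover have "f v2 - v2 \<le> f v1 - v1"
    \<comment> \<open>The slope bound speaks only of distinct points, where it is multiplied by
      \<open>v2 - v1 > 0\<close>.\<close>
    proof (cases "v1 = v2")
      case False
      then have "(f v2 - f v1) / (v2 - v1) \<le> 1"
        using assms(6) v by blast
      moreover have "0 < v2 - v1"
        using False v by simp
      ultimately show ?thesis
        by (simp add: divide_le_eq)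
    qed simp
    then have "0 \<le> C u2 (f v1 - v1) - C u2 (f v2 - v2) - C u1 (f v1 - v1) + C u1 (f v2 - v2)"
      using copula_volume_nonneg assms(1) u v fd by blast
    ultimately show "0 \<le> (C u2 (f v2) - C u2 (f v2 - v2)) - (C u2 (f v1) - C u2 (f v1 - v1))
        - (C u1 (f v2) - C u1 (f v2 - v2)) + (C u1 (f v1) - C u1 (f v1 - v1))"
      by linarith
  \<comment> \<open>The boundary values remain. At \<open>v = 0\<close> the two terms cancel, and at
    \<open>u = 0\<close> both vanish; at \<open>v = 1\<close>, \<open>f 1 = 1\<close> leaves
    \<open>C u 1 - C u 0 = u\<close>; at \<open>u = 1\<close>,
    \<open>f v - (f v - v) = v\<close>.\<close>
  qed (simp_all only: C f fd assms(4), simp_all add: C)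
qed

end
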